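(* Let $G$ be a tree with an $m$-cherry $C=\{l_1,\ldots,l_m\}$ ($m\ge 2$) with center $w$, let $f$ be an admissible vector field on $G$ with leaf component function $h$, and let $\omega\in\Delta_C$. Then: (1) $W_C=\bigoplus_{i=2}^m W_{\{l_1,l_i\}}$; (2) for each $i=2,\ldots,m$, the subspace $W_{\{l_1,l_i\}}$ is invariant under $d_\omega f$; (3) $\partial_1h(\omega_{l_1},\omega_w)$ is an eigenvalue of $d_\omega f$ with algebraic multiplicity at least $m-1$. (If the cell phase space has dimension greater than one, so that $\partial_1h(\omega_{l_1},\omega_w)$ is a linear map, this means that each of its eigenvalues is an eigenvalue of $d_\omega f$ with algebraic multiplicity at least $m-1$.)
   Context: Graphs are finite and simple (undirected, one type of vertex and edge, no multiple edges, no loops). A tree is a connected graph without cycles; a leaf is a vertex of degree one. For an integer $m\ge2$, an $m$-cherry on a tree $G$ is a collection of $m$ (distinct) leaves adjacent to a common vertex $w$, called its center. Each cell (vertex) has the same phase space $P_0=\mathbb{R}^r$, $r\ge1$, and the total phase space is $P=\prod_{c\in V(G)}P_0$ with the standard inner product. A differentiable vector field $f:P\to P$ is admissible if for each cell $c$ the component $f_c(x)$ depends only on $x_c$ and the variables $x_v$ with $v$ adjacent to $c$, and cells of the same degree have the same component function up to relabelling of inputs by any bijection between their neighbor sets (in particular the function is symmetric in the neighbor variables). Hence there is one function $h:P_0\times P_0\to P_0$ with $f_l(x)=h(x_l,x_w)$ for every leaf $l$ with neighbor $w$; $\partial_1h$ is the partial derivative with respect to the first argument. For a set $C$ of leaves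 forming a cherry, $\Delta_C=\{x\in P: x_l=x_{l'}\text{ for all } l,l'\in C\}$ and $W_C$ is the orthogonal complement of $\Delta_C$ in $P$; in particular $W_{\{l_1,l_i\}}$ is the orthogonal complement of $\{x: x_{l_1}=x_{l_i}\}$. $d_\omega f$ is the derivative of $f$ at $\omega$. *)

theory Defs
  imports
    "HOL-Analysis.Analysis"
    "Graph_Theory.Digraph_Component"
    "Jordan_Normal_Form.Char_Poly"
begin

text \<open>
  Both matrix libraries write \<open>$\<close> for vector components; here it always means the
  component of a vector indexed by a finite type.
\<close>
no_notation Matrix.vec_index (infixl \<open>$\<close> 100)


section \<open>Trees and cherries\<close>

text \<open>
  A finite simple graph is a \<^locale>\<open>pair_graph\<close>: a finite loopfree symmetric digraph without
  parallel arcs, every edge being represented by its two orientations. The vertex set is taken to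
  be the whole (finite, otherwise arbitrary) vertex type, so that the phase space can be written
  as a finite Cartesian power.
\<close>

definition simple_graph :: "'v::finite pair_pre_digraph \<Rightarrow> bool" where
  "simple_graph G \<longleftrightarrow> pair_graph G \<and> pverts G = UNIV"

text \<open>
  The library's \<^const>\<open>Digraph_Component.tree\<close> is not used, because in a symmetric digraph
  going back and forth along an edge is a directed cycle of length two; the cycles of
  the undirected graph are those of length at least three.
\<close>

definition tree_graph :: "'v::finite pair_pre_digraph \<Rightarrow> bool" where
  "tree_graph G \<longleftrightarrow> simple_graph G \<and> Digraph_Component.connected (with_proj G)
     \<and> \<not> (\<exists>p. pre_digraph.cycle (with_proj G) p \<and> 3 \<le> length p)"

definition neighbours :: "'v pair_pre_digraph \<Rightarrow> 'v \<Rightarrow> 'v set" where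
  "neighbours G c = {v. (c, v) \<in> parcs G}"

definition degree_of :: "'v pair_pre_digraph \<Rightarrow> 'v \<Rightarrow> nat" where
  "degree_of G c = card (neighbours G c)"

definition leaf :: "'v pair_pre_digraph \<Rightarrow> 'v \<Rightarrow> bool" where
  "leaf G l \<longleftrightarrow> degree_of G l = 1"

definition cherry :: "'v pair_pre_digraph \<Rightarrow> nat \<Rightarrow> 'v set \<Rightarrow> 'v \<Rightarrow> bool" where
  "cherry G m C w \<longleftrightarrow> 2 \<le> m \<and> finite C \<and> card C = m \<and> (\<forall>l\<in>C. leaf G l \<and> w \<in> neighbours G l)"


section \<open>Admissible vector fields\<close>

type_synonym ('r, 'v) phase = "(real ^ 'r) ^ 'v"

text \<open>
  In the last clause \<open>c\<close> and \<open>d\<close> range over all pairs of cells of equal degree, including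
  \<open>c = d\<close>, which is the symmetry of each component in its neighbour variables.
\<close>

definition admissible ::
    "'v::finite pair_pre_digraph \<Rightarrow> (('r::finite, 'v) phase \<Rightarrow> ('r, 'v) phase) \<Rightarrow> bool" where
  "admissible G f \<longleftrightarrow>
     (\<forall>x. f differentiable (at x)) \<and>
     (\<forall>c x y. x $ c = y $ c \<and> (\<forall>v\<in>neighbours G c. x $ v = y $ v) \<longrightarrow> f x $ c = f y $ c) \<and>
     (\<forall>c d \<beta> x y. degree_of G c = degree_of G d \<and> bij_betw \<beta> (neighbours G c) (neighbours G d) \<and>
        x $ c = y $ d \<and> (\<forall>v\<in>neighbours G c. x $ v = y $ \<beta> v) \<longrightarrow> f x $ c = f y $ d)"

definition leaf_component ::
    "'v::finite pair_pre_digraph \<Rightarrow> (('r::finite, 'v) phase \<Rightarrow> ('r, 'v) phase) \<Rightarrow>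
     (real ^ 'r \<Rightarrow> real ^ 'r \<Rightarrow> real ^ 'r) \<Rightarrow> bool" where
  "leaf_component G f h \<longleftrightarrow>
     (\<forall>l w. leaf G l \<and> w \<in> neighbours G l \<longrightarrow> (\<forall>x. f x $ l = h (x $ l) (x $ w)))"

definition partial1 :: "('a::real_normed_vector \<Rightarrow> 'b \<Rightarrow> 'c::real_normed_vector) \<Rightarrow> 'a \<Rightarrow> 'b \<Rightarrow> 'a \<Rightarrow> 'c" where
  "partial1 h a b = frechet_derivative (\<lambda>x. h x b) (at a)"


section \<open>Synchrony subspaces and their complements\<close>

definition Delta :: "'v set \<Rightarrow> ('r::finite, 'v::finite) phase set" where
  "Delta C = {x. \<forall>l\<in>C. \<forall>l'\<in>C. x $ l = x $ l'}"

definition W_comp :: "'v set \<Rightarrow> ('r::finite, 'v::finite) phase set" where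
  "W_comp C = orthogonal_comp (Delta C)"

definition direct_sum_of :: "'a::real_vector set \<Rightarrow> 'i set \<Rightarrow> ('i \<Rightarrow> 'a set) \<Rightarrow> bool" where
  "direct_sum_of U I V \<longleftrightarrow>
     finite I \<and> (\<forall>i\<in>I. subspace (V i)) \<and>
     U = {\<Sum>i\<in>I. u i |u. \<forall>i\<in>I. u i \<in> V i} \<and>
     (\<forall>u. (\<forall>i\<in>I. u i \<in> V i) \<and> (\<Sum>i\<in>I. u i) = 0 \<longrightarrow> (\<forall>i\<in>I. u i = 0))"


section \<open>Eigenvalues of real linear maps\<close>

text \<open>
  Eigenvalues of a real linear map may be complex, so they are those of its matrix over the complex
  numbers. The matrix is taken with respect to the standard basis in some fixed
  enumeration; neither the eigenvalues nor the characteristic polynomial depend on the choice.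
\<close>

definition linmap_mat :: "('a::euclidean_space \<Rightarrow> 'a) \<Rightarrow> complex mat" where
  "linmap_mat T = Matrix.mat DIM('a) DIM('a)
     (\<lambda>(i, j). complex_of_real
        (inner (T (from_nat_into Basis j)) (from_nat_into Basis i)))"

definition linmap_eigenvalue :: "('a::euclidean_space \<Rightarrow> 'a) \<Rightarrow> complex \<Rightarrow> bool" where
  "linmap_eigenvalue T \<mu> \<longleftrightarrow> eigenvalue (linmap_mat T) \<mu>"

definition alg_multiplicity :: "('a::euclidean_space \<Rightarrow> 'a) \<Rightarrow> complex \<Rightarrow> nat" where
  "alg_multiplicity T \<mu> = Polynomial.order \<mu> (char_poly (linmap_mat T))"


section \<open>Sanity checks\<close>

lemma leaf_component_exists:
  fixes f :: "('r::finite, 'v::finite) phase \<Rightarrow> ('r, 'v) phase"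
  assumes "simple_graph G" and adm: "admissible G f"
  shows "\<exists>h. leaf_component G f h"
proof (cases "\<exists>l0. leaf G l0")
  case True
  then obtain l0 where l0: "leaf G l0" by blast
  then obtain w0 where w0: "neighbours G l0 = {w0}"
    unfolding leaf_def degree_of_def by (auto simp: card_1_singleton_iff)
  have "w0 \<noteq> l0"
    using assms(1) w0 pair_loopfree_digraph.pair_no_loops[of G "(l0, w0)"]
    by (auto simp: simple_graph_def neighbours_def pair_graph_def pair_digraph_def)
  define h where "h a b = f (\<chi> v. if v = l0 then a else b) $ l0" for a b
  have "f x $ l = h (x $ l) (x $ w)" if l: "leaf G l" "w \<in> neighbours G l" for l w x
  proof -
    have w: "neighbours G l = {w}"
      using l unfolding leaf_def degree_of_def by (auto simp: card_1_singleton_iff)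
    have "bij_betw (\<lambda>_. w0) (neighbours G l) (neighbours G l0)"
      by (simp add: w w0 bij_betw_def)
    moreover have "degree_of G l = degree_of G l0"
      using l l0 by (simp add: leaf_def)
    moreover
    have "degree_of G c = degree_of G d \<and> bij_betw \<beta> (neighbours G c) (neighbours G d) \<and>
        x $ c = y $ d \<and> (\<forall>v\<in>neighbours G c. x $ v = y $ \<beta> v) \<longrightarrow> f x $ c = f y $ d" for c d \<beta> x y
      using adm unfolding admissible_def by blast
    note this[of l l0 "\<lambda>_. w0" x "\<chi> v. if v = l0 then x $ l else x $ w"]
    ultimately show ?thesis
      using \<open>w0 \<noteq> l0\<close> unfolding h_def by (simp add: w)
  qed
  then show ?thesis unfolding leaf_component_def by blast
qed (auto simp: leaf_component_def)

text \<open>If the space is one-dimensional, the only eigenvalue of a linear map is the scalar it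
  multiplies by.\<close>

lemma linmap_eigenvalue_scalar:
  fixes c :: real
  assumes "DIM('a::euclidean_space) = 1"
  shows "linmap_eigenvalue (\<lambda>x::'a. c *\<^sub>R x) \<mu> \<longleftrightarrow> \<mu> = complex_of_real c"
proof -
  have B: "from_nat_into (Basis :: 'a set) 0 \<in> Basis" by (rule from_nat_into) simp
  have m: "linmap_mat (\<lambda>x::'a. c *\<^sub>R x) = Matrix.mat 1 1 (\<lambda>_. complex_of_real c)"
    unfolding linmap_mat_def assms using B by (intro eq_matI) (auto simp: inner_same_Basis)
  have "char_poly (Matrix.mat 1 1 (\<lambda>_. complex_of_real c)) = [:- complex_of_real c, 1:]"
    unfolding char_poly_defs by (subst det_single) auto
  then show ?thesis
    unfolding linmap_eigenvalue_def m
    by (subst eigenvalue_root_char_poly[of _ 1]) auto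
qed

end

theory Submission
  imports Defs "HOL-Combinatorics.Transposition"
begin

text \<open>
  The transposition of two leaves \<open>l\<^sub>1, l\<^sub>i\<close> of a cherry is a graph automorphism, so it commutes
  with \<open>f\<close> and, fixing \<open>\<omega>\<close>, with \<open>d\<^sub>\<omega>f\<close>. Its eigenspace for \<open>-1\<close> is \<open>W\<^bsub>{l\<^sub>1, l\<^sub>i}\<^esub>\<close>, which is therefore
  invariant. On it \<open>d\<^sub>\<omega>f\<close> acts as \<open>A = \<partial>\<^sub>1h(\<omega>\<^bsub>l\<^sub>1\<^esub>, \<omega>\<^sub>w)\<close>, because the components at \<open>w\<close> vanish. A
  single eigenvector \<open>a\<close> of \<open>A\<close> hence yields \<open>m - 1\<close> independent eigenvectors
  \<open>a \<otimes> (e\<^bsub>l\<^sub>1\<^esub> - e\<^bsub>l\<^sub>i\<^esub>)\<close> of \<open>d\<^sub>\<omega>f\<close>, and the geometric multiplicity bounds the algebraic one from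
  below.
\<close>

no_notation Matrix.scalar_prod (infix "\<bullet>" 70)

section \<open>Geometric multiplicity bounds algebraic multiplicity, for matrices\<close>

text \<open>Each term of the Leibniz expansion takes exactly one entry from every column, hence
  \<open>card J\<close> factors divisible by \<open>d\<close>.\<close>

lemma power_card_dvd_det:
  fixes A :: "'a::comm_ring_1 mat"
  assumes A: "A \<in> carrier_mat n n" and J: "J \<subseteq> {0..<n}"
    and dvd: "\<And>i j. i < n \<Longrightarrow> j \<in> J \<Longrightarrow> d dvd A $$ (i, j)"
  shows "d ^ card J dvd Determinant.det A"
proof -
  have "d ^ card J dvd signof p * (\<Prod>i = 0..<n. A $$ (p i, i))" if p: "p permutes {0..<n}" for p
  proof -
    have "p i < n" if "i < n" for i
      using permutes_in_image[OF p, of i] that by simp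
    then have "(\<Prod>i\<in>J. d) dvd (\<Prod>i\<in>J. A $$ (p i, i))"
      using J by (intro prod_dvd_prod dvd) auto
    also have "\<dots> dvd (\<Prod>i = 0..<n. A $$ (p i, i))"
      by (rule prod_dvd_prod_subset) (use J in auto)
    finally show ?thesis by (simp add: dvd_mult)
  qed
  then show ?thesis
    using A by (subst mat_det_left_def[OF A]) (auto intro!: dvd_sum)
qed

text \<open>In a basis that contains the eigenvectors \<open>v j\<close>, the columns in
  \<open>J\<close> of the matrix are \<open>\<mu>\<close> times unit vectors, so those columns of
  the characteristic matrix are divisible by \<open>X - \<mu>\<close>. The normalisation
  \<open>unit\<close> makes the \<open>v j\<close> independent and lets unit vectors outside
  \<open>J\<close> complete them to an explicit basis.\<close>

lemma card_le_order_char_poly: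
  fixes M :: "'a::field mat"
  assumes M: "M \<in> carrier_mat n n" and J: "J \<subseteq> {0..<n}"
    and v: "\<And>j. j \<in> J \<Longrightarrow> v j \<in> carrier_vec n"
    and eig: "\<And>j. j \<in> J \<Longrightarrow> M *\<^sub>v v j = \<mu> \<cdot>\<^sub>v v j"
    and unit: "\<And>i j. i \<in> J \<Longrightarrow> j \<in> J \<Longrightarrow> Matrix.vec_index (v j) i = (if i = j then 1 else 0)"
  shows "card J \<le> Polynomial.order \<mu> (char_poly M)"
proof -
  \<comment> \<open>\<open>P\<close> has the eigenvectors \<open>v j\<close> as its columns in \<open>J\<close> and unit vectors elsewhere; \<open>N\<^sup>2 = 0\<close>
    makes \<open>R\<close> its inverse.\<close>
  define N where "N = Matrix.mat n n (\<lambda>(i, j). if i \<notin> J \<and> j \<in> J then Matrix.vec_index (v j) i else 0)"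
  define P where "P = 1\<^sub>m n + N"
  define R where "R = 1\<^sub>m n - N"
  have N: "N \<in> carrier_mat n n" by (simp add: N_def)
  then have P: "P \<in> carrier_mat n n" and R: "R \<in> carrier_mat n n"
    by (auto simp: P_def R_def)
  \<comment> \<open>A nonzero entry of \<open>N\<close> has its row outside \<open>J\<close> and its
    column in \<open>J\<close>; the middle index of a product of two such entries would have to be
    both.\<close>
  have NN: "N * N = 0\<^sub>m n n"
    by (rule eq_matI) (auto simp: N_def scalar_prod_def intro!: sum.neutral)
  have PR: "P * R = 1\<^sub>m n"
    unfolding P_def R_def using N NN
    by (simp add: add_mult_distrib_mat[of _ n n _ _ n] mult_minus_distrib_mat[of _ n n _ n])
      (intro eq_matI, auto)
  have RP: "R * P = 1\<^sub>m n"
    using mat_mult_left_right_inverse[OF P R PR] .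
  have colP: "Matrix.col P j = v j" if "j \<in> J" for j
    using that J v[OF that] unit[OF _ that]
    by (intro eq_vecI) (auto simp: P_def N_def subset_iff)
  define B where "B = R * (M * P)"
  have B: "B \<in> carrier_mat n n" using M P R by (simp add: B_def)
  \<comment> \<open>Column \<open>j\<close> of \<open>B\<close> is \<open>R M P\<close> applied to
    the unit vector: \<open>P\<close> sends it to \<open>v j\<close>, \<open>M\<close> scales by
    \<open>\<mu>\<close>, and \<open>R\<close> undoes \<open>P\<close>.\<close>
  have colB: "Matrix.col B j = \<mu> \<cdot>\<^sub>v unit_vec n j" if j: "j \<in> J" for j
  proof -
    have jn: "j < n" using j J by auto
    have "Matrix.col B j = R *\<^sub>v Matrix.col (M * P) j"
      unfolding B_def using M P by (intro col_mult2[OF R _ jn]) simp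
    also have "Matrix.col (M * P) j = M *\<^sub>v v j"
      using col_mult2[OF M P jn] colP[OF j] by simp
    also have "R *\<^sub>v (M *\<^sub>v v j) = \<mu> \<cdot>\<^sub>v (R *\<^sub>v Matrix.col P j)"
      using eig[OF j] R v[OF j] by (simp add: mult_mat_vec[of _ n n] colP[OF j])
    also have "R *\<^sub>v Matrix.col P j = Matrix.col (R * P) j"
      by (rule col_mult2[OF R P jn, symmetric])
    finally show ?thesis using RP jn by simp
  qed
  have "M = P * B * R"
  proof -
    have "P * B = (P * R) * (M * P)" unfolding B_def
      using P R M by (subst assoc_mult_mat[of _ n n _ n _ n]) auto
    then have "P * B * R = M * P * R" using PR M P by simp
    also have "\<dots> = M * (P * R)"
      using M P R by (subst assoc_mult_mat[of _ n n _ n _ n]) auto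
    finally show ?thesis using PR M by simp
  qed
  then have "similar_mat M B"
    using M B P R PR RP by (intro similar_matI[of _ _ P R n]) auto
  then have "char_poly M = char_poly B" by (rule char_poly_similar)
  moreover have "[:- \<mu>, 1:] ^ card J dvd char_poly B"
    unfolding char_poly_def
  proof (rule power_card_dvd_det[OF _ J])
    show "char_poly_matrix B \<in> carrier_mat n n" using B by simp
    fix i j assume i: "i < n" and j: "j \<in> J"
    have jn: "j < n" using j J by auto
    \<comment> \<open>Column \<open>j\<close> of the characteristic matrix is therefore
      \<open>X - \<mu>\<close> on the diagonal and zero elsewhere.\<close>
    have "B $$ (i, j) = Matrix.vec_index (Matrix.col B j) i"
      using i jn B by simp
    also have "\<dots> = (if i = j then \<mu> else 0)" using colB[OF j] i jn by simp
    finally show "[:- \<mu>, 1:] dvd char_poly_matrix B $$ (i, j)"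
      using i jn B by (simp add: char_poly_matrix_def one_pCons)
  qed
  moreover have "char_poly M \<noteq> 0"
    using degree_monic_char_poly[OF M] by auto
  ultimately show ?thesis by (simp add: order_max)
qed

section \<open>Complex eigenvalues of real linear maps, expressed by pairs of real vectors\<close>

text \<open>The coordinate vector of \<open>x + \<i> y\<close> in the complexification, whose basis is enumerated as in
  \<^const>\<open>linmap_mat\<close>.\<close>

definition complex_coords :: "'a::euclidean_space \<Rightarrow> 'a \<Rightarrow> complex Matrix.vec" where
  "complex_coords x y = Matrix.vec DIM('a)
     (\<lambda>i. Complex (x \<bullet> from_nat_into Basis i) (y \<bullet> from_nat_into Basis i))"

lemma complex_coords_carrier [simp]:
  "complex_coords (x::'a::euclidean_space) y \<in> carrier_vec DIM('a)"
  by (simp add: complex_coords_def)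

lemma complex_coords_index:
  fixes x y b :: "'a::euclidean_space"
  assumes "b \<in> Basis"
  shows "to_nat_on Basis b < DIM('a)"
    and "Matrix.vec_index (complex_coords x y) (to_nat_on Basis b) = Complex (x \<bullet> b) (y \<bullet> b)"
proof -
  show "to_nat_on Basis b < DIM('a)"
    using bij_betwE[OF to_nat_on_finite[OF finite_Basis]] assms by auto
  then show "Matrix.vec_index (complex_coords x y) (to_nat_on Basis b) = Complex (x \<bullet> b) (y \<bullet> b)"
    using assms by (simp add: complex_coords_def countable_finite)
qed

lemma complex_coords_inject:
  fixes x y :: "'a::euclidean_space"
  shows "complex_coords x y = complex_coords x' y' \<longleftrightarrow> x = x' \<and> y = y'"
  by (metis complex.inject complex_coords_index(2) euclidean_eqI)

lemma complex_coords_surj: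
  fixes u :: "complex Matrix.vec"
  assumes "u \<in> carrier_vec DIM('a::euclidean_space)"
  obtains x y :: "'a::euclidean_space" where "u = complex_coords x y"
proof -
  define c :: "'a \<Rightarrow> complex" where "c b = Matrix.vec_index u (to_nat_on Basis b)" for b
  define x y :: 'a where "x = (\<Sum>b\<in>Basis. Re (c b) *\<^sub>R b)" and "y = (\<Sum>b\<in>Basis. Im (c b) *\<^sub>R b)"
  have "c (from_nat_into Basis i) = Matrix.vec_index u i" if "i < DIM('a)" for i
  proof -
    have "i \<in> to_nat_on Basis ` (Basis :: 'a set)"
      using that bij_betw_imp_surj_on[OF to_nat_on_finite[of "Basis :: 'a set", OF finite_Basis]] by auto
    then show ?thesis by (simp add: c_def)
  qed
  moreover have "from_nat_into Basis i \<in> (Basis :: 'a set)" for i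
    by (rule from_nat_into) simp
  ultimately have "u = complex_coords x y"
    using assms by (intro eq_vecI) (auto simp: complex_coords_def x_def y_def)
  then show ?thesis by (rule that)
qed

text \<open>These are the real and imaginary parts of the product of \<open>\<mu>\<close> with x + i
  y.\<close>

lemma smult_complex_coords:
  "\<mu> \<cdot>\<^sub>v complex_coords x y
     = complex_coords (Re \<mu> *\<^sub>R x - Im \<mu> *\<^sub>R y) (Im \<mu> *\<^sub>R x + Re \<mu> *\<^sub>R y)"
  by (rule eq_vecI) (auto simp: complex_coords_def complex_eq_iff inner_simps)

lemma linmap_mat_carrier [simp]:
  "linmap_mat (T :: 'a::euclidean_space \<Rightarrow> 'a) \<in> carrier_mat DIM('a) DIM('a)"
  by (simp add: linmap_mat_def)

text \<open>The matrix has real entries, so it acts on real and imaginary parts separately, each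
  time as \<open>T\<close> does.\<close>

lemma linmap_mat_mult_complex_coords:
  fixes T :: "'a::euclidean_space \<Rightarrow> 'a"
  assumes "linear T"
  shows "linmap_mat T *\<^sub>v complex_coords x y = complex_coords (T x) (T y)"
proof (rule eq_vecI)
  fix i assume "i < dim_vec (complex_coords (T x) (T y))"
  then have i: "i < DIM('a)" by (simp add: complex_coords_def)
  let ?e = "from_nat_into (Basis :: 'a set)"
  \<comment> \<open>This is the matrix product for one real vector; \<open>z\<close> becomes
    \<open>x\<close> for the real part and \<open>y\<close> for the imaginary part.\<close>
  have *: "(\<Sum>j = 0..<DIM('a). (T (?e j) \<bullet> ?e i) * (z \<bullet> ?e j)) = T z \<bullet> ?e i" for z
  proof -
    have "(\<Sum>j = 0..<DIM('a). (T (?e j) \<bullet> ?e i) * (z \<bullet> ?e j))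
        = (\<Sum>b\<in>Basis. (T b \<bullet> ?e i) * (z \<bullet> b))"
      using sum.reindex_bij_betw[OF bij_betw_from_nat_into_finite[of "Basis :: 'a set", OF finite_Basis],
          of "\<lambda>b. (T b \<bullet> ?e i) * (z \<bullet> b)"]
      by (simp add: lessThan_atLeast0)
    also have "\<dots> = T (\<Sum>b\<in>Basis. (z \<bullet> b) *\<^sub>R b) \<bullet> ?e i"
      by (simp add: linear_sum[OF assms] linear_cmul[OF assms] inner_sum_left mult.commute)
    finally show ?thesis by (simp add: euclidean_representation)
  qed
  show "Matrix.vec_index (linmap_mat T *\<^sub>v complex_coords x y) i = Matrix.vec_index (complex_coords (T x) (T y)) i"
    using i *[of x] *[of y]
    by (simp add: complex_coords_def linmap_mat_def scalar_prod_def complex_eq_iff)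
qed (simp_all add: complex_coords_def linmap_mat_def)

text \<open>Separating real and imaginary parts of the eigenvector equation lets later arguments
  stay within the real phase space.\<close>

lemma linmap_mat_eigenvector_iff:
  fixes T :: "'a::euclidean_space \<Rightarrow> 'a"
  assumes "linear T"
  shows "linmap_mat T *\<^sub>v complex_coords x y = \<mu> \<cdot>\<^sub>v complex_coords x y \<longleftrightarrow>
    T x = Re \<mu> *\<^sub>R x - Im \<mu> *\<^sub>R y \<and> T y = Im \<mu> *\<^sub>R x + Re \<mu> *\<^sub>R y"
  by (simp add: linmap_mat_mult_complex_coords[OF assms] smult_complex_coords complex_coords_inject)

lemma linmap_eigenvalueE:
  fixes T :: "'a::euclidean_space \<Rightarrow> 'a"
  assumes "linear T" and "linmap_eigenvalue T \<mu>"
  obtains x y where "x \<noteq> 0 \<or> y \<noteq> 0"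
    "T x = Re \<mu> *\<^sub>R x - Im \<mu> *\<^sub>R y" "T y = Im \<mu> *\<^sub>R x + Re \<mu> *\<^sub>R y"
proof -
  obtain u where u: "u \<in> carrier_vec DIM('a)" "u \<noteq> 0\<^sub>v DIM('a)" "linmap_mat T *\<^sub>v u = \<mu> \<cdot>\<^sub>v u"
    using assms(2) unfolding linmap_eigenvalue_def eigenvalue_def eigenvector_def
    by (auto simp: linmap_mat_def)
  obtain x y :: 'a where xy: "u = complex_coords x y"
    using u(1) by (rule complex_coords_surj)
  have "x \<noteq> 0 \<or> y \<noteq> 0"
    using u(2) unfolding xy by (force simp: complex_coords_def complex_eq_iff)
  then show ?thesis
    using that u(3) linmap_mat_eigenvector_iff[OF assms(1)] unfolding xy by blast
qed

text \<open>A positive order makes \<open>\<mu>\<close> a root of the characteristic polynomial. A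
  multiplicity bound thus also yields the eigenvalue property.\<close>

lemma linmap_eigenvalue_if_alg_multiplicity_pos:
  fixes T :: "'a::euclidean_space \<Rightarrow> 'a"
  assumes "0 < alg_multiplicity T \<mu>"
  shows "linmap_eigenvalue T \<mu>"
  using assms order_0I[of "char_poly (linmap_mat T)" \<mu>]
  unfolding linmap_eigenvalue_def alg_multiplicity_def
  by (subst eigenvalue_root_char_poly[OF linmap_mat_carrier]) auto

text \<open>The members of \<open>S\<close> serve as pivots: the complex eigenvector attached to
  \<open>b\<close> is nonzero at \<open>b\<close> and zero at the other pivots, so rescaling brings
  the family into the form required by \<open>card_le_order_char_poly\<close>.\<close>

lemma card_le_alg_multiplicity:
  fixes T :: "'a::euclidean_space \<Rightarrow> 'a"
  assumes T: "linear T" and S: "S \<subseteq> Basis"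
    and eig: "\<And>b. b \<in> S \<Longrightarrow> T (x b) = Re \<mu> *\<^sub>R x b - Im \<mu> *\<^sub>R y b"
      "\<And>b. b \<in> S \<Longrightarrow> T (y b) = Im \<mu> *\<^sub>R x b + Re \<mu> *\<^sub>R y b"
    and nz: "\<And>b. b \<in> S \<Longrightarrow> x b \<bullet> b \<noteq> 0 \<or> y b \<bullet> b \<noteq> 0"
    and z: "\<And>b b'. b \<in> S \<Longrightarrow> b' \<in> S \<Longrightarrow> b' \<noteq> b \<Longrightarrow> x b \<bullet> b' = 0 \<and> y b \<bullet> b' = 0"
  shows "card S \<le> alg_multiplicity T \<mu>"
proof -
  let ?k = "to_nat_on (Basis :: 'a set)" and ?e = "from_nat_into (Basis :: 'a set)"
  \<comment> \<open>Division by the pivot coordinate, nonzero by \<open>nz\<close>, makes that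
    coordinate equal to 1.\<close>
  define v where "v j = (1 / Complex (x (?e j) \<bullet> ?e j) (y (?e j) \<bullet> ?e j))
     \<cdot>\<^sub>v complex_coords (x (?e j)) (y (?e j))" for j
  have ek: "?e (?k b) = b" if "b \<in> S" for b
    using that S by (auto simp: countable_finite)
  have "card (?k ` S) \<le> Polynomial.order \<mu> (char_poly (linmap_mat T))"
  proof (rule card_le_order_char_poly[OF linmap_mat_carrier, where v = v])
    show "?k ` S \<subseteq> {0..<DIM('a)}" using S complex_coords_index(1)[where 'a = 'a] by auto
    fix j assume "j \<in> ?k ` S"
    then obtain b where b: "b \<in> S" "j = ?k b" by auto
    show "v j \<in> carrier_vec DIM('a)" by (simp add: v_def)
    have "linmap_mat T *\<^sub>v complex_coords (x b) (y b) = \<mu> \<cdot>\<^sub>v complex_coords (x b) (y b)"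
      using eig b by (simp add: linmap_mat_eigenvector_iff[OF T])
    then show "linmap_mat T *\<^sub>v v j = \<mu> \<cdot>\<^sub>v v j"
      by (simp add: v_def b ek mult_mat_vec[OF linmap_mat_carrier] smult_smult_assoc mult.commute)
    fix i assume "i \<in> ?k ` S"
    then obtain b' where b': "b' \<in> S" "i = ?k b'" by auto
    have "b' \<in> Basis" using b' S by auto
    note ix = complex_coords_index[OF this]
    have "Complex (x b \<bullet> b) (y b \<bullet> b) \<noteq> 0" using nz[OF b(1)] by (simp add: complex_eq_iff)
    moreover have "Complex (x b \<bullet> b') (y b \<bullet> b') = 0" if "b \<noteq> b'"
      using z[OF b(1) b'(1)] that by (simp add: complex_eq_iff)
    moreover have "i = j \<longleftrightarrow> b' = b" using ek b b' by metis
    moreover have "Matrix.vec_index (v j) i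
        = 1 / Complex (x b \<bullet> b) (y b \<bullet> b) * Complex (x b \<bullet> b') (y b \<bullet> b')"
      using ix(1) unfolding v_def b(2) b'(2) ek[OF b(1)] ix(2)[symmetric]
      by (subst index_smult_vec) (simp_all add: complex_coords_def)
    ultimately show "Matrix.vec_index (v j) i = (if i = j then 1 else 0)"
      by (cases "b' = b") simp_all
  qed
  moreover have "inj_on ?k S"
    using ek by (metis inj_onI)
  ultimately show ?thesis
    by (simp add: card_image alg_multiplicity_def)
qed

section \<open>Complements of synchrony subspaces\<close>

text \<open>Elements of \<open>Delta C\<close> are arbitrary off \<open>C\<close> and constant on
  \<open>C\<close>. Orthogonality to the first freedom kills the coordinates off \<open>C\<close>;
  orthogonality to the second kills the sum over \<open>C\<close>.\<close>

lemma W_comp_iff: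
  fixes x :: "('r::finite, 'v::finite) phase"
  assumes "C \<noteq> {}"
  shows "x \<in> W_comp C \<longleftrightarrow> (\<forall>c. c \<notin> C \<longrightarrow> x $ c = 0) \<and> (\<Sum>c\<in>C. x $ c) = 0"
proof (intro iffI conjI allI impI)
  assume x: "x \<in> W_comp C"
  have orth: "(\<Sum>c\<in>UNIV. y $ c \<bullet> x $ c) = 0" if "y \<in> Delta C" for y
  proof -
    have "y \<bullet> x = 0"
      using x that by (simp add: W_comp_def orthogonal_comp_def real_inner_class.orthogonal_def)
    then show ?thesis by (simp only: inner_vec_def)
  qed
  show "x $ c = 0" if "c \<notin> C" for c
  proof -
    have "axis c (x $ c) \<in> Delta C"
      using that by (auto simp: Delta_def axis_def)
    then show ?thesis
      using x by (auto simp: W_comp_def orthogonal_comp_def real_inner_class.orthogonal_def inner_axis')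
  qed
  \<comment> \<open>The test vector with value \<open>?s\<close> on \<open>C\<close> and 0 elsewhere
    lies in \<open>Delta C\<close>; its inner product with \<open>x\<close> is the squared norm of
    \<open>?s\<close>.\<close>
  let ?s = "\<Sum>c\<in>C. x $ c"
  have "(\<Sum>c\<in>UNIV. (if c \<in> C then ?s else 0) \<bullet> x $ c) = (\<Sum>c\<in>C. ?s \<bullet> x $ c)"
    by (rule sum.mono_neutral_cong_right) auto
  then show "?s = 0"
    using orth[of "\<chi> c. if c \<in> C then ?s else 0"] by (simp add: Delta_def flip: inner_sum_right)
next
  assume x: "(\<forall>c. c \<notin> C \<longrightarrow> x $ c = 0) \<and> (\<Sum>c\<in>C. x $ c) = 0"
  obtain a where a: "a \<in> C" using assms by auto
  have "y \<bullet> x = 0" if "y \<in> Delta C" for y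
  proof -
    have "y \<bullet> x = (\<Sum>c\<in>UNIV. y $ c \<bullet> x $ c)" by (simp only: inner_vec_def)
    also have "\<dots> = (\<Sum>c\<in>C. y $ c \<bullet> x $ c)"
      by (rule sum.mono_neutral_right) (use x in auto)
    also have "\<dots> = (\<Sum>c\<in>C. y $ a \<bullet> x $ c)"
      by (intro sum.cong refl arg_cong2[where f = inner]) (use a that in \<open>unfold Delta_def, blast\<close>)
    also have "\<dots> = y $ a \<bullet> (\<Sum>c\<in>C. x $ c)" by (rule inner_sum_right[symmetric])
    finally show ?thesis using x by simp
  qed
  then show "x \<in> W_comp C"
    by (simp add: W_comp_def orthogonal_comp_def real_inner_class.orthogonal_def)
qed

text \<open>A cell fixed by the swap satisfies \<open>x $ c = - x $ c\<close> and so carries 0,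
  while the two swapped cells carry opposite values. In this form, invariance follows from commuting
  with the swap.\<close>

lemma W_comp_pair_iff:
  fixes x :: "('r::finite, 'v::finite) phase"
  assumes "a \<noteq> b"
  shows "x \<in> W_comp {a, b} \<longleftrightarrow> (\<chi> c. x $ Transposition.transpose a b c) = - x"
proof -
  have "x \<in> W_comp {a, b} \<longleftrightarrow> (\<forall>c. c \<noteq> a \<and> c \<noteq> b \<longrightarrow> x $ c = 0) \<and> x $ a = - x $ b"
    using assms by (simp add: W_comp_iff eq_neg_iff_add_eq_0)
  also have "\<dots> \<longleftrightarrow> (\<forall>c. x $ Transposition.transpose a b c = - x $ c)" (is "?l \<longleftrightarrow> ?r")
  proof (intro iffI conjI allI impI)
    fix c assume ?l
    then show "x $ Transposition.transpose a b c = - x $ c"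
      by (cases "c = a"; cases "c = b") simp_all
  next
    assume ?r
    from spec[OF this, of b] show "x $ a = - x $ b" by simp
    fix c assume "c \<noteq> a \<and> c \<noteq> b"
    then have *: "x $ c = - x $ c" using spec[OF \<open>?r\<close>, of c] by simp
    have "x $ c $ i = 0" for i
      using arg_cong[OF *, of "\<lambda>y. y $ i"] by simp
    then show "x $ c = 0" by (simp add: Finite_Cartesian_Product.vec_eq_iff)
  qed
  also have "\<dots> \<longleftrightarrow> (\<chi> c. x $ Transposition.transpose a b c) = - x"
    unfolding Finite_Cartesian_Product.vec_eq_iff[of _ "- x"] by simp
  finally show ?thesis .
qed

lemma subspace_W_comp: "subspace (W_comp C)"
  by (simp add: W_comp_def subspace_orthogonal_comp)

lemma W_comp_mono: "A \<subseteq> B \<Longrightarrow> W_comp A \<subseteq> W_comp B"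
  unfolding W_comp_def by (rule orthogonal_comp_anti_mono) (auto simp: Delta_def)

text \<open>Every summand has support in \<open>l 1\<close> and its own leaf \<open>l i\<close>. The
  coordinates at \<open>l 2\<close>, ..., \<open>l m\<close> therefore determine all components, and
  the coordinate at \<open>l 1\<close> is settled by the vanishing sum over
  \<open>C\<close>.\<close>

lemma W_comp_direct_sum:
  fixes l :: "nat \<Rightarrow> 'v::finite"
  assumes m: "1 \<le> m" and l: "bij_betw l {1..m} C"
  shows "direct_sum_of (W_comp C :: ('r::finite, 'v) phase set) {2..m} (\<lambda>i. W_comp {l 1, l i})"
proof -
  have ne: "l i = l j \<longleftrightarrow> i = j" if "i \<in> {1..m}" "j \<in> {1..m}" for i j
    using inj_on_eq_iff[OF bij_betw_imp_inj_on[OF l] that] .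
  have C: "C = l ` {1..m}" using bij_betw_imp_surj_on[OF l] by simp
  \<comment> \<open>Only the summand with index \<open>j\<close> can be nonzero at
    \<open>l j\<close>, since \<open>j\<close> is not 1.\<close>
  have coord: "(\<Sum>i\<in>{2..m}. u i) $ l j = u j $ l j"
    if u: "\<forall>i\<in>{2..m}. u i \<in> W_comp {l 1, l i}" and j: "j \<in> {2..m}"
    for u :: "nat \<Rightarrow> ('r, 'v) phase" and j
  proof -
    have "(\<Sum>i\<in>{2..m}. u i $ l j) = (\<Sum>i\<in>{j}. u i $ l j)"
      by (rule sum.mono_neutral_right) (use u j ne in \<open>auto simp: W_comp_iff\<close>)
    then show ?thesis by simp
  qed
  show ?thesis
    unfolding direct_sum_of_def
  proof (intro conjI ballI allI impI Set.set_eqI iffI)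
    fix x :: "('r, 'v) phase" assume x: "x \<in> W_comp C"
    \<comment> \<open>The only possible choice: the value of \<open>x\<close> at \<open>l i\<close>,
      balanced by its negative at \<open>l 1\<close>.\<close>
    define u :: "nat \<Rightarrow> ('r, 'v) phase" where
      "u i = (\<chi> c. if c = l i then x $ l i else if c = l 1 then - x $ l i else 0)" for i
    have u: "u i \<in> W_comp {l 1, l i}" if "i \<in> {2..m}" for i
      using that ne[of 1 i] by (auto simp: W_comp_iff u_def)
    have x0: "x $ c = 0" if "c \<notin> C" for c
      using x that C m by (auto simp: W_comp_iff)
    have "(\<Sum>c\<in>C. x $ c) = (\<Sum>i\<in>{1..m}. x $ l i)"
      using sum.reindex_bij_betw[OF l] by metis
    also have "{1..m} = insert 1 {2..m}" using m by auto
    also have "(\<Sum>i\<in>\<dots>. x $ l i) = x $ l 1 + (\<Sum>i\<in>{2..m}. x $ l i)" by simp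
    finally have x1: "x $ l 1 = - (\<Sum>i\<in>{2..m}. x $ l i)"
      using x C m by (auto simp: W_comp_iff add_eq_0_iff2)
    have "(\<Sum>i\<in>{2..m}. u i) $ c = x $ c" for c
    proof -
      consider "c \<notin> C" | "c = l 1" | j where "j \<in> {2..m}" "c = l j"
      proof (cases "c \<in> C")
        case True
        then obtain j where j: "j \<in> {1..m}" "c = l j" using C by blast
        then show ?thesis using that(2) that(3)[of j] by (cases "j = 1") auto
      qed (rule that(1))
      then show ?thesis
      proof cases
        case 1
        then have "u i $ c = 0" if "i \<in> {2..m}" for i
          using that C m by (auto simp: u_def)
        then show ?thesis using x0[OF 1] by simp
      next
        case 2
        have "u i $ c = - x $ l i" if "i \<in> {2..m}" for i
          using that ne[of 1 i] 2 by (auto simp: u_def)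
        then show ?thesis using x1 2 by (simp add: sum_negf)
      next
        case 3
        then show ?thesis using coord[of u] u by (simp add: u_def)
      qed
    qed
    then have "x = (\<Sum>i\<in>{2..m}. u i)" by (simp add: Finite_Cartesian_Product.vec_eq_iff)
    then show "x \<in> {\<Sum>i\<in>{2..m}. u i |u. \<forall>i\<in>{2..m}. u i \<in> W_comp {l 1, l i}}"
      using u by blast
  next
    fix x :: "('r, 'v) phase"
    assume "x \<in> {\<Sum>i\<in>{2..m}. u i |u. \<forall>i\<in>{2..m}. u i \<in> W_comp {l 1, l i}}"
    then obtain u where u: "\<And>i. i \<in> {2..m} \<Longrightarrow> u i \<in> W_comp {l 1, l i}" "x = (\<Sum>i\<in>{2..m}. u i)"
      by blast
    have "W_comp {l 1, l i} \<subseteq> (W_comp C :: ('r, 'v) phase set)" if "i \<in> {2..m}" for i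
      using that C m by (intro W_comp_mono) auto
    then show "x \<in> W_comp C"
      unfolding u(2) using u(1) by (intro subspace_sum[OF subspace_W_comp]) blast
  next
    fix u :: "nat \<Rightarrow> ('r, 'v) phase" and i
    assume u: "(\<forall>i\<in>{2..m}. u i \<in> W_comp {l 1, l i}) \<and> (\<Sum>i\<in>{2..m}. u i) = 0" and i: "i \<in> {2..m}"
    \<comment> \<open>Vanishing at \<open>l i\<close> forces vanishing at \<open>l 1\<close>, where
      the value is opposite; elsewhere \<open>u i\<close> is zero anyway.\<close>
    then have "u i $ l i = 0" using coord[of u i] by simp
    moreover have "u i \<in> W_comp {l 1, l i}" using u i by blast
    ultimately have "u i $ c = 0" for c
      using ne[of 1 i] i by (cases "c = l 1 \<or> c = l i") (auto simp: W_comp_iff)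
    then show "u i = 0" by (simp add: Finite_Cartesian_Product.vec_eq_iff)
  qed (simp_all add: subspace_W_comp)
qed

section \<open>Graph symmetries, the vector field and its derivative\<close>

text \<open>Admissibility is applied to the cells \<open>c\<close> and \<open>\<pi> c\<close> with
  \<open>\<pi>\<close> itself as the bijection of neighbours: cell \<open>c\<close> in the permuted
  state sees exactly what \<open>\<pi> c\<close> sees in \<open>x\<close>.\<close>

lemma admissible_equivariant:
  fixes f :: "('r::finite, 'v::finite) phase \<Rightarrow> ('r, 'v) phase"
  assumes "admissible G f" and "inj \<pi>"
    and "\<And>c. neighbours G (\<pi> c) = \<pi> ` neighbours G c"
  shows "f (\<chi> c. x $ \<pi> c) = (\<chi> c. f x $ \<pi> c)"
proof -
  have bij: "bij_betw \<pi> (neighbours G c) (neighbours G (\<pi> c))" for c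
    using assms(2,3) by (auto simp: bij_betw_def intro: inj_on_subset)
  have deg: "degree_of G c = degree_of G (\<pi> c)" for c
    using bij_betw_same_card[OF bij] by (simp add: degree_of_def)
  have "\<forall>c d \<beta> x y. degree_of G c = degree_of G d \<and> bij_betw \<beta> (neighbours G c) (neighbours G d) \<and>
        x $ c = y $ d \<and> (\<forall>v\<in>neighbours G c. x $ v = y $ \<beta> v) \<longrightarrow> f x $ c = f y $ d"
    using assms(1) unfolding admissible_def by blast
  then have "f (\<chi> c. x $ \<pi> c) $ c = f x $ \<pi> c" for c
    using bij[of c] deg[of c] by (metis (no_types, lifting) vec_lambda_beta)
  then show ?thesis by (simp add: Finite_Cartesian_Product.vec_eq_iff)
qed

text \<open>The chain rule differentiates both sides of
  \<open>f \<circ> \<sigma> = \<sigma> \<circ> f\<close> at \<open>\<omega>\<close>. Because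
  \<open>\<sigma>\<close> fixes \<open>\<omega>\<close>, the same derivative of \<open>f\<close>
  occurs on both sides, and derivatives are unique.\<close>

lemma frechet_derivative_equivariant:
  fixes f :: "'a::real_normed_vector \<Rightarrow> 'a"
  assumes "bounded_linear \<sigma>" and "\<And>x. f (\<sigma> x) = \<sigma> (f x)"
    and "\<sigma> \<omega> = \<omega>" and "f differentiable (at \<omega>)"
  shows "frechet_derivative f (at \<omega>) (\<sigma> x) = \<sigma> (frechet_derivative f (at \<omega>) x)"
proof -
  let ?T = "frechet_derivative f (at \<omega>)"
  have T: "(f has_derivative ?T) (at \<omega>)"
    using assms(4) by (simp add: frechet_derivative_works)
  have "((f \<circ> \<sigma>) has_derivative (?T \<circ> \<sigma>)) (at \<omega>)"
    using T assms(3) by (intro diff_chain_at bounded_linear_imp_has_derivative assms(1)) simp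
  moreover have "((\<sigma> \<circ> f) has_derivative (\<sigma> \<circ> ?T)) (at \<omega>)"
    by (intro diff_chain_at bounded_linear_imp_has_derivative assms(1) T)
  moreover have "f \<circ> \<sigma> = \<sigma> \<circ> f" using assms(2) by auto
  ultimately have "?T \<circ> \<sigma> = \<sigma> \<circ> ?T" by (metis has_derivative_unique)
  then show ?thesis by (metis comp_apply)
qed

lemma simple_graph_neighbours:
  assumes "simple_graph G"
  shows "v \<in> neighbours G c \<longleftrightarrow> c \<in> neighbours G v" and "c \<notin> neighbours G c"
proof -
  interpret pair_graph G using assms by (simp add: simple_graph_def)
  show "v \<in> neighbours G c \<longleftrightarrow> c \<in> neighbours G v"
    by (auto simp: neighbours_def intro: arcs_symmetric)
  show "c \<notin> neighbours G c"
    using no_loops' by (auto simp: neighbours_def)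
qed

lemma leaf_neighbours: "leaf G a \<Longrightarrow> w \<in> neighbours G a \<Longrightarrow> neighbours G a = {w}"
  by (auto simp: leaf_def degree_of_def card_1_singleton_iff)

text \<open>Both leaves have \<open>{w}\<close> as neighbour set, and the swap fixes
  \<open>w\<close>. The neighbour set of any other cell contains both leaves or neither, so the swap
  preserves it.\<close>

lemma transpose_leaves_automorphism:
  assumes G: "simple_graph G"
    and a: "leaf G a" "w \<in> neighbours G a" and b: "leaf G b" "w \<in> neighbours G b"
  shows "neighbours G (Transposition.transpose a b c) = Transposition.transpose a b ` neighbours G c"
proof -
  note Na = leaf_neighbours[OF a] and Nb = leaf_neighbours[OF b]
  have w: "w \<noteq> a" "w \<noteq> b" using simple_graph_neighbours(2)[OF G] a b by auto
  \<comment> \<open>By symmetry of the edges, either side says that \<open>c\<close> is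
    \<open>w\<close>.\<close>
  have "a \<in> neighbours G c \<longleftrightarrow> b \<in> neighbours G c" for c
    using simple_graph_neighbours(1)[OF G, of a c] simple_graph_neighbours(1)[OF G, of b c] Na Nb
    by auto
  then show ?thesis
    using w Na Nb by (cases "c = a \<or> c = b") auto
qed

section \<open>The derivative on a pair of leaves with common neighbour\<close>

text \<open>This identifies the partial derivative of component \<open>c\<close> in the variable of
  cell \<open>b\<close> with the corresponding block of the total derivative.\<close>

lemma has_derivative_upd:
  fixes f :: "('r::finite, 'v::finite) phase \<Rightarrow> ('r, 'v) phase"
  assumes "f differentiable (at \<omega>)"
  shows "((\<lambda>a. f (\<chi> v. if v = b then a else \<omega> $ v) $ c) has_derivative
    (\<lambda>z. frechet_derivative f (at \<omega>) (axis b z) $ c)) (at (\<omega> $ b))"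
proof -
  let ?u = "\<lambda>a::real^'r. (\<chi> v. if v = b then a else \<omega> $ v)"
  have T: "(f has_derivative frechet_derivative f (at \<omega>)) (at (?u (\<omega> $ b)))"
  proof -
    have "?u (\<omega> $ b) = \<omega>" by (simp add: Finite_Cartesian_Product.vec_eq_iff)
    then show ?thesis using assms by (simp add: frechet_derivative_works)
  qed
  have "bounded_linear (axis b :: real^'r \<Rightarrow> _)"
    by (rule linear_conv_bounded_linear[THEN iffD1], rule linearI)
      (auto simp: axis_def Finite_Cartesian_Product.vec_eq_iff)
  \<comment> \<open>Replacing the value at \<open>b\<close> is an affine map:
    \<open>\<omega>\<close> with its entry at \<open>b\<close> set to zero, plus
    \<open>axis b a\<close>.\<close>
  then have "((\<lambda>a. (\<chi> v. if v = b then 0 else \<omega> $ v) + axis b a) has_derivative axis b) (at (\<omega> $ b))"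
    by (auto intro!: derivative_eq_intros bounded_linear_imp_has_derivative)
  moreover have "?u = (\<lambda>a. (\<chi> v. if v = b then 0 else \<omega> $ v) + axis b a)"
    by (auto simp: fun_eq_iff Finite_Cartesian_Product.vec_eq_iff axis_def)
  ultimately have u: "(?u has_derivative axis b) (at (\<omega> $ b))" by simp
  show ?thesis
    using bounded_linear.has_derivative[OF bounded_linear_vec_nth[of c] diff_chain_at[OF u T]]
    by (simp add: o_def)
qed

context
  fixes G :: "'v::finite pair_pre_digraph" and w a b :: 'v
    and f :: "('r::finite, 'v) phase \<Rightarrow> ('r, 'v) phase"
    and h :: "real ^ 'r \<Rightarrow> real ^ 'r \<Rightarrow> real ^ 'r" and \<omega> :: "('r, 'v) phase"
  assumes G: "simple_graph G" and adm: "admissible G f" and h: "leaf_component G f h"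
    and a: "leaf G a" "w \<in> neighbours G a" 
begin

lemma differentiable_admissible: "f differentiable (at \<omega>)"
  using adm unfolding admissible_def by blast

lemma linear_frechet: "linear (frechet_derivative f (at \<omega>))"
  using differentiable_admissible by (rule linear_frechet_derivative)

text \<open>Component \<open>a\<close> of \<open>f\<close> is \<open>h\<close> of the states of
  \<open>a\<close> and \<open>w\<close> alone. Varying the state of \<open>a\<close> gives the
  partial derivative of \<open>h\<close>; varying a cell other than these two leaves the component
  constant.\<close>

lemma leaf_derivative:
  shows "partial1 h (\<omega> $ a) (\<omega> $ w) z = frechet_derivative f (at \<omega>) (axis a z) $ a"
    and "b \<noteq> a \<Longrightarrow> b \<noteq> w \<Longrightarrow> frechet_derivative f (at \<omega>) (axis b z) $ a = 0"
proof -
  have fa: "f x $ a = h (x $ a) (x $ w)" for x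
    using h a by (simp add: leaf_component_def)
  have "w \<noteq> a" using simple_graph_neighbours(2)[OF G] a by auto
  then have "((\<lambda>z. h z (\<omega> $ w)) has_derivative
      (\<lambda>z. frechet_derivative f (at \<omega>) (axis a z) $ a)) (at (\<omega> $ a))"
    using has_derivative_upd[OF differentiable_admissible, of a a] by (simp add: fa)
  then have "(\<lambda>z. frechet_derivative f (at \<omega>) (axis a z) $ a) = partial1 h (\<omega> $ a) (\<omega> $ w)"
    unfolding partial1_def by (rule frechet_derivative_at)
  then show "partial1 h (\<omega> $ a) (\<omega> $ w) z = frechet_derivative f (at \<omega>) (axis a z) $ a"
    by metis
  assume "b \<noteq> a" "b \<noteq> w"
  then have "((\<lambda>z::real^'r. h (\<omega> $ a) (\<omega> $ w)) has_derivative
      (\<lambda>z. frechet_derivative f (at \<omega>) (axis b z) $ a)) (at (\<omega> $ b))"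
    using has_derivative_upd[OF differentiable_admissible, of b a] by (simp add: fa)
  then have "(\<lambda>z. frechet_derivative f (at \<omega>) (axis b z) $ a) = (\<lambda>z. 0)"
    by (rule has_derivative_unique) simp
  then show "frechet_derivative f (at \<omega>) (axis b z) $ a = 0" by metis
qed

text \<open>The map is the block of the derivative of \<open>f\<close> from cell \<open>a\<close> to
  itself, and inherits its linearity.\<close>

lemma linear_partial1: "linear (partial1 h (\<omega> $ a) (\<omega> $ w))"
proof -
  have "linear (\<lambda>z. axis a z :: ('r, 'v) phase)"
    by (rule linearI) (auto simp: axis_def Finite_Cartesian_Product.vec_eq_iff)
  then have "linear ((\<lambda>x. x $ a) \<circ> frechet_derivative f (at \<omega>) \<circ> axis a)"
    by (intro linear_compose linear_frechet) (auto intro: linearI)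
  then show ?thesis by (simp add: o_def leaf_derivative(1)[abs_def])
qed

context
  assumes b: "leaf G b" "w \<in> neighbours G b" and ab: "a \<noteq> b" and \<omega>: "\<omega> $ a = \<omega> $ b"
begin

text \<open>The derivative commutes with the swap and hence maps its eigenspace for -1 into
  itself.\<close>

lemma frechet_derivative_W_comp_pair:
  assumes "x \<in> W_comp {a, b}"
  shows "frechet_derivative f (at \<omega>) x \<in> W_comp {a, b}"
proof -
  define \<sigma> :: "('r, 'v) phase \<Rightarrow> ('r, 'v) phase" where
    "\<sigma> x = (\<chi> c. x $ Transposition.transpose a b c)" for x
  have iff: "x \<in> W_comp {a, b} \<longleftrightarrow> \<sigma> x = - x" for x
    by (simp add: W_comp_pair_iff[OF ab] \<sigma>_def)
  have "frechet_derivative f (at \<omega>) (\<sigma> x) = \<sigma> (frechet_derivative f (at \<omega>) x)"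
  proof (rule frechet_derivative_equivariant)
    show "bounded_linear \<sigma>"
      by (rule linear_conv_bounded_linear[THEN iffD1], rule linearI)
        (auto simp: \<sigma>_def Finite_Cartesian_Product.vec_eq_iff)
    show "f (\<sigma> x) = \<sigma> (f x)" for x
      unfolding \<sigma>_def
      by (intro admissible_equivariant[OF adm] transpose_leaves_automorphism[OF G a b] inj_transpose)
    show "\<sigma> \<omega> = \<omega>" using \<omega> by (auto simp: \<sigma>_def Finite_Cartesian_Product.vec_eq_iff Transposition.transpose_def)
  qed (rule differentiable_admissible)
  then show ?thesis
    using assms by (simp add: iff linear_neg[OF linear_frechet])
qed

text \<open>The image lies in \<open>W_comp {a, b}\<close>, so its coordinate at \<open>a\<close>
  determines it. That coordinate is the partial derivative of \<open>h\<close> at \<open>z\<close>,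
  because leaf \<open>a\<close> does not see leaf \<open>b\<close>.\<close>

lemma frechet_derivative_antisymmetric:
  "frechet_derivative f (at \<omega>) (axis a z - axis b z)
    = axis a (partial1 h (\<omega> $ a) (\<omega> $ w) z) - axis b (partial1 h (\<omega> $ a) (\<omega> $ w) z)"
proof -
  let ?T = "frechet_derivative f (at \<omega>)" and ?A = "partial1 h (\<omega> $ a) (\<omega> $ w)"
  have "b \<noteq> w" using simple_graph_neighbours(2)[OF G] b by auto
  then have "?T (axis b z) $ a = 0" using ab by (intro leaf_derivative(2)) auto
  moreover have "?T (axis a z - axis b z) = ?T (axis a z) - ?T (axis b z)"
    by (rule linear_diff[OF linear_frechet])
  ultimately have 1: "?T (axis a z - axis b z) $ a = ?A z"
    by (simp add: leaf_derivative(1))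
  have "axis a z - axis b z \<in> W_comp {a, b}"
    using ab by (simp add: W_comp_iff axis_def)
  then have "?T (axis a z - axis b z) \<in> W_comp {a, b}"
    by (rule frechet_derivative_W_comp_pair)
  then have 2: "?T (axis a z - axis b z) $ b = - ?A z"
    "\<And>c. c \<noteq> a \<Longrightarrow> c \<noteq> b \<Longrightarrow> ?T (axis a z - axis b z) $ c = 0"
    using ab 1 by (auto simp: W_comp_iff add_eq_0_iff)
  show ?thesis
  proof (rule Finite_Cartesian_Product.vec_eq_iff[THEN iffD2], rule allI)
    fix c
    show "?T (axis a z - axis b z) $ c = (axis a (?A z) - axis b (?A z)) $ c"
      using 1 2(1) 2(2)[of c] ab by (cases "c = a"; cases "c = b") (simp_all add: axis_def)
  qed
qed

end

end

section \<open>Eigenvectors for the pairs \<open>l 1\<close>, \<open>l i\<close> and the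
  multiplicity bound\<close>

theorem corollary4p3:
  fixes G :: "'v::finite pair_pre_digraph"
    and C :: "'v set" and w :: 'v and m :: nat and l :: "nat \<Rightarrow> 'v"
    and f :: "('r::finite, 'v) phase \<Rightarrow> ('r, 'v) phase"
    and h :: "real ^ 'r \<Rightarrow> real ^ 'r \<Rightarrow> real ^ 'r"
    and \<omega> :: "('r, 'v) phase"
  assumes "tree_graph G"
    and "cherry G m C w"
    and "bij_betw l {1..m} C"
    and "admissible G f"
    and "leaf_component G f h"
    and "\<omega> \<in> Delta C"
  shows "direct_sum_of (W_comp C :: ('r, 'v) phase set) {2..m} (\<lambda>i. W_comp {l 1, l i})
    \<and> (\<forall>i\<in>{2..m}. frechet_derivative f (at \<omega>) ` W_comp {l 1, l i} \<subseteq> W_comp {l 1, l i})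
    \<and> (\<forall>\<mu>. linmap_eigenvalue (partial1 h (\<omega> $ l 1) (\<omega> $ w)) \<mu> \<longrightarrow>
          linmap_eigenvalue (frechet_derivative f (at \<omega>)) \<mu>
          \<and> m - 1 \<le> alg_multiplicity (frechet_derivative f (at \<omega>)) \<mu>)"
proof -
  let ?T = "frechet_derivative f (at \<omega>)" and ?A = "partial1 h (\<omega> $ l 1) (\<omega> $ w)"
  have G: "simple_graph G" using assms(1) by (simp add: tree_graph_def)
  have m: "2 \<le> m" and C: "\<And>c. c \<in> C \<Longrightarrow> leaf G c \<and> w \<in> neighbours G c"
    using assms(2) by (auto simp: cherry_def)
  have lC: "l i \<in> C" if "i \<in> {1..m}" for i
    using bij_betw_apply[OF assms(3) that] .
  have ne: "l i = l j \<longleftrightarrow> i = j" if "i \<in> {1..m}" "j \<in> {1..m}" for i j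
    using inj_on_eq_iff[OF bij_betw_imp_inj_on[OF assms(3)] that] .
  have l1: "leaf G (l 1)" "w \<in> neighbours G (l 1)" using C[OF lC, of 1] m by auto
  have li: "leaf G (l i)" "w \<in> neighbours G (l i)" "l 1 \<noteq> l i" "\<omega> $ l 1 = \<omega> $ l i"
    if "i \<in> {2..m}" for i
  proof -
    have i: "i \<in> {1..m}" "1 \<in> {1..m}" using that by auto
    show "leaf G (l i)" "w \<in> neighbours G (l i)" using C[OF lC[OF i(1)]] by auto
    show "l 1 \<noteq> l i" using ne[OF i(2,1)] that by auto
    show "\<omega> $ l 1 = \<omega> $ l i" using assms(6) lC[OF i(1)] lC[OF i(2)] unfolding Delta_def by blast
  qed
  note linT = linear_frechet[OF G assms(4,5) l1, of \<omega>]
  have mult: "m - 1 \<le> alg_multiplicity ?T \<mu>" if ev: "linmap_eigenvalue ?A \<mu>" for \<mu>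
  proof -
    obtain X Y where XY: "X \<noteq> 0 \<or> Y \<noteq> 0"
      "?A X = Re \<mu> *\<^sub>R X - Im \<mu> *\<^sub>R Y" "?A Y = Im \<mu> *\<^sub>R X + Re \<mu> *\<^sub>R Y"
      using linmap_eigenvalueE[OF linear_partial1[OF G assms(4,5) l1] ev] by blast
    \<comment> \<open>The coordinate \<open>q\<close> detects the eigenvector X + i Y of
      \<open>?A\<close> and supplies the pivots: \<open>e i\<close> is the standard basis vector for
      cell \<open>l i\<close> and coordinate \<open>q\<close>, with \<open>i\<close> from 2 to
      \<open>m\<close>, which makes \<open>m - 1\<close> of them.\<close>
    obtain q where q: "X $ q \<noteq> 0 \<or> Y $ q \<noteq> 0"
      using XY(1) by (auto simp: Finite_Cartesian_Product.vec_eq_iff)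
    define e :: "nat \<Rightarrow> ('r, 'v) phase" where "e i = axis (l i) (axis q 1)" for i
    \<comment> \<open>Eigenvectors are indexed by their pivots in
      \<open>card_le_alg_multiplicity\<close>; \<open>k\<close> recovers the leaf index from the
      pivot.\<close>
    define k where "k = inv_into {2..m} e"
    define E where "E i Z = (axis (l 1) Z - axis (l i) Z :: ('r, 'v) phase)" for i Z
    have inj: "inj_on e {2..m}"
      using ne by (auto simp: inj_on_def e_def axis_eq_axis)
    have k: "k (e i) = i" if "i \<in> {2..m}" for i
      using inj that by (simp add: k_def)
    have TE: "?T (E i Z) = E i (?A Z)" if "i \<in> {2..m}" for i Z
      unfolding E_def
      using frechet_derivative_antisymmetric[OF G assms(4,5) l1] li[OF that] by blast
    have E_lin: "E i (r *\<^sub>R Z + s *\<^sub>R Z') = r *\<^sub>R E i Z + s *\<^sub>R E i Z'"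
      "E i (r *\<^sub>R Z - s *\<^sub>R Z') = r *\<^sub>R E i Z - s *\<^sub>R E i Z'" for i r s Z Z'
      by (auto simp: E_def Finite_Cartesian_Product.vec_eq_iff axis_def algebra_simps)
    \<comment> \<open>All \<open>E i Z\<close> share the cell \<open>l 1\<close>, but no pivot lies
      there. At the leaves \<open>l 2\<close>, ..., \<open>l m\<close> only \<open>l i\<close>
      carries a value, namely \<open>- Z\<close>.\<close>
    have E_inner: "E i Z \<bullet> e j = (if i = j then - Z $ q else 0)"
      if "i \<in> {2..m}" "j \<in> {2..m}" for i j Z
      using that ne[of i j] ne[of 1 j]
      by (auto simp: E_def e_def inner_axis) (auto simp: axis_def)
    have "card (e ` {2..m}) \<le> alg_multiplicity ?T \<mu>"
    proof (rule card_le_alg_multiplicity[OF linT, where x = "\<lambda>b. E (k b) X" and y = "\<lambda>b. E (k b) Y"])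
      show "e ` {2..m} \<subseteq> Basis" by (auto simp: e_def)
      fix b assume "b \<in> e ` {2..m}"
      then obtain i where i: "i \<in> {2..m}" "b = e i" by auto
      show "?T (E (k b) X) = Re \<mu> *\<^sub>R E (k b) X - Im \<mu> *\<^sub>R E (k b) Y"
        "?T (E (k b) Y) = Im \<mu> *\<^sub>R E (k b) X + Re \<mu> *\<^sub>R E (k b) Y"
        unfolding i(2) k[OF i(1)] TE[OF i(1)] XY(2,3) E_lin by (rule refl)+
      show "E (k b) X \<bullet> b \<noteq> 0 \<or> E (k b) Y \<bullet> b \<noteq> 0"
        unfolding i(2) k[OF i(1)] using q by (simp add: E_inner[OF i(1) i(1)])
      fix b' assume "b' \<in> e ` {2..m}" and ne': "b' \<noteq> b"
      then obtain j where j: "j \<in> {2..m}" "b' = e j" by auto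
      then have "i \<noteq> j" using ne' i(2) by auto
      then show "E (k b) X \<bullet> b' = 0 \<and> E (k b) Y \<bullet> b' = 0"
        unfolding i(2) k[OF i(1)] j(2) by (simp add: E_inner[OF i(1) j(1)])
    qed
    then show ?thesis by (simp add: card_image[OF inj])
  qed
  \<comment> \<open>Since \<open>m\<close> is at least 2, the bound \<open>m - 1\<close> is
    positive, so the multiplicity is positive as well.\<close>
  moreover have "linmap_eigenvalue ?T \<mu>" if "linmap_eigenvalue ?A \<mu>" for \<mu>
    using linmap_eigenvalue_if_alg_multiplicity_pos[of ?T \<mu>] mult[OF that] m by auto
  moreover have "?T ` W_comp {l 1, l i} \<subseteq> W_comp {l 1, l i}" if "i \<in> {2..m}" for i
    using frechet_derivative_W_comp_pair[OF G assms(4,5) l1] li[OF that] by blast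
  ultimately show ?thesis
    using W_comp_direct_sum[OF _ assms(3)] m by auto
qed

end
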